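(* (1) Let $H$ be a universal graph. Then $Z_H(\bullet)$ is a complete invariant for finite posets; that is, for any two finite posets $P_1$ and $P_2$, one has $Z_H(P_1)=Z_H(P_2)$ if and only if $P_1$ and $P_2$ are isomorphic as posets. (2) Let $\{H_n\}_{n\in\mathbb{N}}$ be an infinite sequence of universal graphs. Then $\{Z_{H_n}(\bullet)\}_{n\in\mathbb{N}}$ is a complete invariant for finite posets; that is, for any two finite posets $P_1$ and $P_2$, one has $Z_{H_n}(P_1)=Z_{H_n}(P_2)$ for all $n\in\mathbb{N}$ if and only if $P_1$ and $P_2$ are isomorphic as posets.
   Context: Undirected graphs are simple. An infinite graph $H$ is universal if it contains every finite graph as an induced subgraph (up to isomorphism). A homomorphism $\varphi:V(G)\to V(H)$ is a map such that $\{u,v\}\in E(G)$ implies $\{\varphi(u),\varphi(v)\}\in E(H)$; $\mathrm{Hom}(G,H)$ is the set of homomorphisms. For a finite graph $G$ with weight function $w:V(G)\to\{1,2,3,\dots\}$ and a graph $H$, with indeterminates $x=\{x_u\}_{u\in V(H)}$, define the formal power series $$X_H(G,w)=\sum_{\varphi\in\mathrm{Hom}(G,H)}\ \prod_{v\in V(G)}x_{\varphi(v)}^{w(v)}.$$ For a finite poset $P$, let $\vec{G}_P$ be the directed graph of its Hasse diagram: the vertex set is $P$, with an arc $u\to v$ exactly when $v$ covers $u$. Let $G_P$ be the undirected graph obtained from $\vec{G}_P$ by forgetting directions, and define $w_P$ on $V(G_P)$ recursively by $w_P(v)=1$ if the in-degree of $v$ in $\vec{G}_P$ is $0$, and $w_P(v)=1+\max_{u:\,u\to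 v}w_P(u)$ otherwise. Put $Z_H(P)=X_H(G_P,w_P)$. *)

theory Defs
  imports
    "HOL-Library.FuncSet"
    "HOL-Library.Poly_Mapping"
    "Graph_Theory.Pair_Digraph"
begin

section \<open>Undirected simple graphs\<close>

record 'a ugraph =
  uverts :: "'a set"
  uedges :: "'a set set"

definition simple_graph :: "'a ugraph \<Rightarrow> bool" where
  "simple_graph G \<longleftrightarrow> (\<forall>e\<in>uedges G. e \<subseteq> uverts G \<and> card e = 2)"

definition induced_ugraph :: "'a ugraph \<Rightarrow> 'a set \<Rightarrow> 'a ugraph" where
  "induced_ugraph H S = \<lparr>uverts = S, uedges = {e \<in> uedges H. e \<subseteq> S}\<rparr>"

definition ugraph_isomorphic :: "'a ugraph \<Rightarrow> 'b ugraph \<Rightarrow> bool" where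
  "ugraph_isomorphic G H \<longleftrightarrow>
    (\<exists>f. bij_betw f (uverts G) (uverts H) \<and>
      (\<forall>u\<in>uverts G. \<forall>v\<in>uverts G. {u, v} \<in> uedges G \<longleftrightarrow> {f u, f v} \<in> uedges H))"

text \<open>Every finite graph has an isomorphic copy with vertices in \<^typ>\<open>nat\<close>, so it suffices
  to let the finite graph range over \<^typ>\<open>nat ugraph\<close>.\<close>

definition universal_graph :: "'h ugraph \<Rightarrow> bool" where
  "universal_graph H \<longleftrightarrow>
    simple_graph H \<and> infinite (uverts H) \<and>
    (\<forall>G :: nat ugraph. simple_graph G \<and> finite (uverts G) \<longrightarrow>
      (\<exists>S \<subseteq> uverts H. ugraph_isomorphic G (induced_ugraph H S)))"

definition Hom :: "'a ugraph \<Rightarrow> 'h ugraph \<Rightarrow> ('a \<Rightarrow> 'h) set" where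
  "Hom G H = {\<phi> \<in> uverts G \<rightarrow>\<^sub>E uverts H.
     \<forall>u v. {u, v} \<in> uedges G \<longrightarrow> {\<phi> u, \<phi> v} \<in> uedges H}"


section \<open>The power series of a weighted graph\<close>

text \<open>A monomial in the indeterminates \<open>x\<^sub>u\<close> is given by its exponent vector, a finitely supported
  function, so that monomials are multiplied by adding exponent vectors. A power series is the
  family of its coefficients.\<close>

type_synonym 'h pseries = "('h \<Rightarrow>\<^sub>0 nat) \<Rightarrow> int"

definition monomial_series :: "('h \<Rightarrow>\<^sub>0 nat) \<Rightarrow> 'h pseries" where
  "monomial_series e = (\<lambda>m. if m = e then 1 else 0)"

text \<open>The sum is taken coefficientwise; it is meaningful for families in which each coefficient is
  nonzero for only finitely many indices.\<close>

definition formal_sum :: "'i set \<Rightarrow> ('i \<Rightarrow> 'h pseries) \<Rightarrow> 'h pseries" where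
  "formal_sum I F = (\<lambda>m. \<Sum>i\<in>{i \<in> I. F i m \<noteq> 0}. F i m)"

definition hom_monomial :: "'a ugraph \<Rightarrow> ('a \<Rightarrow> nat) \<Rightarrow> ('a \<Rightarrow> 'h) \<Rightarrow> ('h \<Rightarrow>\<^sub>0 nat)" where
  "hom_monomial G w \<phi> = (\<Sum>v\<in>uverts G. Poly_Mapping.single (\<phi> v) (w v))"

definition X_series :: "'h ugraph \<Rightarrow> 'a ugraph \<Rightarrow> ('a \<Rightarrow> nat) \<Rightarrow> 'h pseries" where
  "X_series H G w = formal_sum (Hom G H) (\<lambda>\<phi>. monomial_series (hom_monomial G w \<phi>))"

lemma lookup_hom_monomial:
  "Poly_Mapping.lookup (hom_monomial G w \<phi>) x = (\<Sum>v\<in>uverts G. if \<phi> v = x then w v else 0)"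
  by (simp add: hom_monomial_def lookup_sum lookup_single when_def)

text \<open>For positive weights the sum defining \<^const>\<open>X_series\<close> is meaningful.\<close>

lemma X_series_locally_finite:
  fixes m :: "'h \<Rightarrow>\<^sub>0 nat"
  assumes fin: "finite (uverts G)" and pos: "\<And>v. v \<in> uverts G \<Longrightarrow> w v \<ge> 1"
  shows "finite {\<phi> \<in> Hom G H. hom_monomial G w \<phi> = m}"
proof (rule finite_subset)
  show "{\<phi> \<in> Hom G H. hom_monomial G w \<phi> = m} \<subseteq> uverts G \<rightarrow>\<^sub>E Poly_Mapping.keys m"
  proof (clarify, rule PiE_I)
    fix \<phi> v
    assume \<phi>: "\<phi> \<in> Hom G H" and m: "m = hom_monomial G w \<phi>" and v: "v \<in> uverts G"
    have "w v \<le> (\<Sum>u\<in>uverts G. if \<phi> u = \<phi> v then w u else 0)"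
      using member_le_sum[of v "uverts G" "\<lambda>u. if \<phi> u = \<phi> v then w u else 0"] fin v by simp
    then have "Poly_Mapping.lookup m (\<phi> v) \<noteq> 0"
      using pos[OF v] m by (simp add: lookup_hom_monomial)
    then show "\<phi> v \<in> Poly_Mapping.keys (hom_monomial G w \<phi>)"
      using m by (simp add: in_keys_iff)
  qed (auto simp: Hom_def)
  show "finite (uverts G \<rightarrow>\<^sub>E Poly_Mapping.keys m)"
    using fin by (intro finite_PiE) auto
qed

lemma X_series_coeff:
  "X_series H G w m = int (card {\<phi> \<in> Hom G H. hom_monomial G w \<phi> = m})"
proof -
  have "{\<phi> \<in> Hom G H. monomial_series (hom_monomial G w \<phi>) m \<noteq> 0}
      = {\<phi> \<in> Hom G H. hom_monomial G w \<phi> = m}"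
    by (auto simp: monomial_series_def)
  then show ?thesis
    by (simp add: X_series_def formal_sum_def monomial_series_def)
qed


section \<open>Finite posets\<close>

text \<open>A poset is a carrier together with its reflexive order relation.\<close>

definition finite_poset :: "'a set \<Rightarrow> 'a rel \<Rightarrow> bool" where
  "finite_poset P r \<longleftrightarrow> finite P \<and> partial_order_on P r"

definition poset_isomorphic :: "'a set \<Rightarrow> 'a rel \<Rightarrow> 'b set \<Rightarrow> 'b rel \<Rightarrow> bool" where
  "poset_isomorphic P r Q s \<longleftrightarrow>
    (\<exists>f. bij_betw f P Q \<and> (\<forall>x\<in>P. \<forall>y\<in>P. (x, y) \<in> r \<longleftrightarrow> (f x, f y) \<in> s))"

text \<open>\<open>covers P r v u\<close>: the element \<open>v\<close> covers \<open>u\<close>.\<close>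

definition covers :: "'a set \<Rightarrow> 'a rel \<Rightarrow> 'a \<Rightarrow> 'a \<Rightarrow> bool" where
  "covers P r v u \<longleftrightarrow> u \<in> P \<and> v \<in> P \<and> (u, v) \<in> r \<and> u \<noteq> v \<and>
    \<not> (\<exists>z\<in>P. z \<noteq> u \<and> z \<noteq> v \<and> (u, z) \<in> r \<and> (z, v) \<in> r)"

definition hasse_digraph :: "'a set \<Rightarrow> 'a rel \<Rightarrow> 'a pair_pre_digraph" where
  "hasse_digraph P r = \<lparr>pverts = P, parcs = {(u, v). covers P r v u}\<rparr>"

definition underlying_ugraph :: "'a pair_pre_digraph \<Rightarrow> 'a ugraph" where
  "underlying_ugraph D = \<lparr>uverts = pverts D, uedges = {{u, v} | u v. (u, v) \<in> parcs D}\<rparr>"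

text \<open>Recursion along the arcs. The recursion equation holds whenever the arc relation is
  well-founded, in particular for the Hasse diagram of a finite poset; see
  \<open>poset_weight_rec\<close>.\<close>

definition digraph_weight :: "'a pair_pre_digraph \<Rightarrow> 'a \<Rightarrow> nat" where
  "digraph_weight D = wfrec (parcs D)
    (\<lambda>w v. if in_degree (with_proj D) v = 0 then 1 else 1 + Max {w u | u. (u, v) \<in> parcs D})"

definition poset_graph :: "'a set \<Rightarrow> 'a rel \<Rightarrow> 'a ugraph" where
  "poset_graph P r = underlying_ugraph (hasse_digraph P r)"

definition poset_weight :: "'a set \<Rightarrow> 'a rel \<Rightarrow> 'a \<Rightarrow> nat" where
  "poset_weight P r = digraph_weight (hasse_digraph P r)"

definition Z_series :: "'h ugraph \<Rightarrow> 'a set \<Rightarrow> 'a rel \<Rightarrow> 'h pseries" where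
  "Z_series H P r = X_series H (poset_graph P r) (poset_weight P r)"

lemma simple_graph_poset_graph: "simple_graph (poset_graph P r)"
  by (auto simp: simple_graph_def poset_graph_def underlying_ugraph_def hasse_digraph_def covers_def)

lemma wf_hasse_digraph:
  assumes "finite_poset P r"
  shows "wf (parcs (hasse_digraph P r))"
proof -
  have po: "partial_order_on P r" and fin: "finite P"
    using assms by (auto simp: finite_poset_def)
  have tr: "trans r" and an: "antisym r" and sub: "r \<subseteq> P \<times> P"
    using po by (auto simp: partial_order_on_def preorder_on_def)
  have "finite (r - Id)"
    using fin sub by (meson finite_Diff finite_SigmaI finite_subset)
  moreover have "acyclic (r - Id)"
    using tr an by (metis acyclic_irrefl irrefl_diff_Id trancl_id trans_diff_Id)
  ultimately have "wf (r - Id)"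
    by (rule finite_acyclic_wf)
  then show ?thesis
    by (rule wf_subset) (auto simp: hasse_digraph_def covers_def)
qed

lemma poset_weight_rec:
  assumes "finite_poset P r"
  shows "poset_weight P r v =
    (if in_degree (with_proj (hasse_digraph P r)) v = 0 then 1
     else 1 + Max {poset_weight P r u | u. (u, v) \<in> parcs (hasse_digraph P r)})"
proof -
  let ?R = "parcs (hasse_digraph P r)"
  have "{cut f ?R v u | u. (u, v) \<in> ?R} = {f u | u. (u, v) \<in> ?R}" for f :: "'a \<Rightarrow> nat"
    by (auto simp: cut_apply) (metis cut_apply)
  then show ?thesis
    unfolding poset_weight_def digraph_weight_def
    by (subst wfrec[OF wf_hasse_digraph[OF assms]]) simp
qed

lemma poset_weight_pos: "finite_poset P r \<Longrightarrow> poset_weight P r v \<ge> 1"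
  by (subst poset_weight_rec) auto

end

theory Submission
  imports Defs
begin

text \<open>A universal graph \<open>H\<close> contains \<open>G\<^sub>1\<close> as an induced subgraph via some \<open>\<phi>\<close>. If the two series
  agree, the monomial of \<open>\<phi>\<close> is also that of a homomorphism \<open>\<psi>\<close> from \<open>G\<^sub>2\<close>, so \<open>G\<^sub>2\<close> has at least as
  many vertices as \<open>G\<^sub>1\<close>; by symmetry equally many. Hence \<open>\<psi>\<close> is injective with the same image as
  \<open>\<phi>\<close>, and \<open>\<phi>\<^sup>-\<^sup>1 \<psi>\<close> is a bijective homomorphism from \<open>G\<^sub>2\<close> to \<open>G\<^sub>1\<close> preserving weights. Such maps exist in
  both directions, so the edge counts agree and it is an isomorphism. Finally, the weights orient
  the edges of the Hasse diagram, and the order is the reflexive transitive closure of the covering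
  relation.\<close>

section \<open>Weighted isomorphisms and edges of simple graphs\<close>

text \<open>The notion through which both directions pass: equality of the series amounts to it for
  weighted graphs, and for Hasse diagrams with their weights it amounts to isomorphism of the
  posets.\<close>

definition weighted_graph_iso ::
    "('a \<Rightarrow> 'b) \<Rightarrow> 'a ugraph \<Rightarrow> ('a \<Rightarrow> nat) \<Rightarrow> 'b ugraph \<Rightarrow> ('b \<Rightarrow> nat) \<Rightarrow> bool" where
  "weighted_graph_iso f G w G' w' \<longleftrightarrow> bij_betw f (uverts G) (uverts G') \<and>
     (\<forall>u\<in>uverts G. \<forall>v\<in>uverts G. {u, v} \<in> uedges G \<longleftrightarrow> {f u, f v} \<in> uedges G') \<and>
     (\<forall>v\<in>uverts G. w' (f v) = w v)"

lemma simple_graph_edgeE: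
  assumes "simple_graph G" "e \<in> uedges G"
  obtains u v where "e = {u, v}" "u \<in> uverts G" "v \<in> uverts G" "u \<noteq> v"
proof -
  have "card e = 2" "e \<subseteq> uverts G"
    using assms by (auto simp: simple_graph_def)
  then show ?thesis
    using that by (auto simp: card_2_iff)
qed

lemma simple_graph_edgeD:
  assumes "simple_graph G" "{u, v} \<in> uedges G"
  shows "u \<in> uverts G" "v \<in> uverts G" "u \<noteq> v"
  using assms by (auto simp: simple_graph_def)

lemma finite_uedges: "simple_graph G \<Longrightarrow> finite (uverts G) \<Longrightarrow> finite (uedges G)"
  by (rule finite_subset[of _ "Pow (uverts G)"]) (auto simp: simple_graph_def)

lemma weighted_graph_iso_inv:
  assumes "weighted_graph_iso f G w G' w'"
  shows "weighted_graph_iso (inv_into (uverts G) f) G' w' G w"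
proof -
  let ?g = "inv_into (uverts G) f"
  have f: "bij_betw f (uverts G) (uverts G')"
    using assms by (simp add: weighted_graph_iso_def)
  have g: "bij_betw ?g (uverts G') (uverts G)"
    using f by (rule bij_betw_inv_into)
  have gv: "?g v \<in> uverts G" "f (?g v) = v" if "v \<in> uverts G'" for v
    using f g that by (auto simp: bij_betw_inv_into_right bij_betwE)
  show ?thesis
    using assms g gv unfolding weighted_graph_iso_def by metis
qed

section \<open>Embedding finite graphs into a universal graph\<close>

text \<open>Reflection of edges records that the copy inside \<open>H\<close> is induced; it is what
  later allows edges to be carried back from \<open>H\<close> to \<open>G\<close>.\<close>

lemma universal_graph_embedding:
  fixes G :: "'a ugraph"
  assumes H: "universal_graph H" and G: "simple_graph G" and fin: "finite (uverts G)"
  obtains \<phi> where "\<phi> \<in> Hom G H" "inj_on \<phi> (uverts G)"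
    "\<And>u v. u \<in> uverts G \<Longrightarrow> v \<in> uverts G \<Longrightarrow> {\<phi> u, \<phi> v} \<in> uedges H \<Longrightarrow> {u, v} \<in> uedges G"
proof -
  obtain h :: "'a \<Rightarrow> nat" where h: "inj_on h (uverts G)"
    using finite_imp_inj_to_nat_seg[OF fin] by auto
  \<comment> \<open>Universality is stated for graphs on \<open>nat\<close>, so \<open>G\<close> is
    first copied there along \<open>h\<close>.\<close>
  define N where "N = \<lparr>uverts = h ` uverts G, uedges = (`) h ` uedges G\<rparr>"
  have edge_N: "{h u, h v} \<in> uedges N \<longleftrightarrow> {u, v} \<in> uedges G"
    if "u \<in> uverts G" "v \<in> uverts G" for u v
  proof -
    \<comment> \<open>Taking images under \<open>h\<close> is injective on sets of vertices of
      \<open>G\<close>, so no non-edge of \<open>G\<close> can become an edge of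
      \<open>N\<close>.\<close>
    have "{u, v} \<in> Pow (uverts G)" "uedges G \<subseteq> Pow (uverts G)"
      using that G by (auto simp: simple_graph_def)
    then have "h ` {u, v} \<in> (`) h ` uedges G \<longleftrightarrow> {u, v} \<in> uedges G"
      by (rule inj_on_image_mem_iff[OF inj_on_image_Pow[OF h]])
    then show ?thesis by (simp add: N_def)
  qed
  have "card (h ` e) = 2" if "e \<in> uedges G" for e
    using G that h by (metis card_image inj_on_subset simple_graph_def)
  then have "simple_graph N" "finite (uverts N)"
    using G fin by (auto simp: simple_graph_def N_def)
  then obtain S where S: "S \<subseteq> uverts H" "ugraph_isomorphic N (induced_ugraph H S)"
    using H unfolding universal_graph_def by blast
  then obtain g where g: "bij_betw g (uverts N) S"
    and edge_g: "\<And>u v. u \<in> uverts N \<Longrightarrow> v \<in> uverts N \<Longrightarrow>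
      {u, v} \<in> uedges N \<longleftrightarrow> {g u, g v} \<in> uedges (induced_ugraph H S)"
    by (auto simp: ugraph_isomorphic_def induced_ugraph_def)
  \<comment> \<open>The restriction makes the composite extensional, as membership in
    \<open>Hom\<close> demands.\<close>
  define \<phi> where "\<phi> = restrict (g \<circ> h) (uverts G)"
  have hN: "h v \<in> uverts N" if "v \<in> uverts G" for v
    using that by (simp add: N_def)
  have \<phi>S: "\<phi> v \<in> S" if "v \<in> uverts G" for v
    using g hN[OF that] that by (auto simp: \<phi>_def bij_betwE)
  have edge: "{\<phi> u, \<phi> v} \<in> uedges H \<longleftrightarrow> {u, v} \<in> uedges G"
    if "u \<in> uverts G" "v \<in> uverts G" for u v
  proof -
    have "{\<phi> u, \<phi> v} \<in> uedges H \<longleftrightarrow> {\<phi> u, \<phi> v} \<in> uedges (induced_ugraph H S)"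
      using \<phi>S that by (auto simp: induced_ugraph_def)
    also have "\<dots> \<longleftrightarrow> {h u, h v} \<in> uedges N"
      using edge_g hN that by (simp add: \<phi>_def)
    finally show ?thesis using edge_N that by simp
  qed
  show ?thesis
  proof (rule that)
    show "\<phi> \<in> Hom G H"
      unfolding Hom_def
    proof (intro CollectI conjI allI impI)
      show "\<phi> \<in> uverts G \<rightarrow>\<^sub>E uverts H"
        using \<phi>S S(1) by (intro PiE_I) (auto simp: \<phi>_def)
      show "{\<phi> u, \<phi> v} \<in> uedges H" if "{u, v} \<in> uedges G" for u v
        using edge simple_graph_edgeD[OF G that] that by blast
    qed
    have "inj_on (g \<circ> h) (uverts G)"
      using h g by (auto simp: N_def bij_betw_def intro: comp_inj_on)
    then show "inj_on \<phi> (uverts G)"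
      by (simp add: \<phi>_def inj_on_restrict_eq)
  qed (use edge in blast)
qed

section \<open>Reading a map off its monomial\<close>

text \<open>Exponents are sums of positive weights, so nothing cancels and the variables that occur
  are exactly the values of the map.\<close>

lemma keys_hom_monomial:
  assumes "finite (uverts G)" and "\<And>v. v \<in> uverts G \<Longrightarrow> w v \<ge> 1"
  shows "Poly_Mapping.keys (hom_monomial G w \<phi>) = \<phi> ` uverts G"
proof -
  have "(\<Sum>v\<in>uverts G. if \<phi> v = x then w v else 0) \<noteq> 0 \<longleftrightarrow> x \<in> \<phi> ` uverts G" for x
    using assms(1) by (auto simp: sum_eq_0_iff dest: assms(2))
      (metis assms(2) less_eq_Suc_le One_nat_def)
  then show ?thesis
    by (auto simp: in_keys_iff lookup_hom_monomial)
qed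

lemma lookup_hom_monomial_inj:
  assumes "finite (uverts G)" "inj_on \<phi> (uverts G)" "v \<in> uverts G"
  shows "Poly_Mapping.lookup (hom_monomial G w \<phi>) (\<phi> v) = w v"
proof -
  have "(\<Sum>u\<in>uverts G. if \<phi> u = \<phi> v then w u else 0) = (\<Sum>u\<in>uverts G. if u = v then w u else 0)"
    using assms by (intro sum.cong) (auto simp: inj_on_eq_iff)
  then show ?thesis
    using assms by (simp add: lookup_hom_monomial)
qed

section \<open>Recovering the weighted graph from its series\<close>

text \<open>A coefficient counts the homomorphisms with the given monomial, so a monomial realised
  on one side has nonzero coefficient on both.\<close>

lemma X_series_eq_hom_monomial:
  assumes eq: "X_series H G w = X_series H G' w'" and "\<phi> \<in> Hom G H"
    and "finite (uverts G)" and "\<And>v. v \<in> uverts G \<Longrightarrow> w v \<ge> 1"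
  obtains \<psi> where "\<psi> \<in> Hom G' H" "hom_monomial G' w' \<psi> = hom_monomial G w \<phi>"
proof -
  let ?m = "hom_monomial G w \<phi>"
  \<comment> \<open>The set contains \<open>\<phi>\<close>; local finiteness excludes the default
    value 0 of \<open>card\<close> on infinite sets.\<close>
  have "card {\<psi> \<in> Hom G H. hom_monomial G w \<psi> = ?m} \<noteq> 0"
    using assms X_series_locally_finite[of G w H ?m] by auto
  then have "card {\<psi> \<in> Hom G' H. hom_monomial G' w' \<psi> = ?m} \<noteq> 0"
    using fun_cong[OF eq, of ?m] by (simp add: X_series_coeff)
  then show ?thesis
    using that by (metis (mono_tags, lifting) card.empty empty_Collect_eq)
qed

lemma X_series_eq_card_le:
  assumes "universal_graph H" "simple_graph G"
    and fin: "finite (uverts G)" "finite (uverts G')"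
    and pos: "\<And>v. v \<in> uverts G \<Longrightarrow> w v \<ge> 1" "\<And>v. v \<in> uverts G' \<Longrightarrow> w' v \<ge> 1"
    and eq: "X_series H G w = X_series H G' w'"
  shows "card (uverts G) \<le> card (uverts G')"
proof -
  obtain \<phi> where \<phi>: "\<phi> \<in> Hom G H" "inj_on \<phi> (uverts G)"
    using universal_graph_embedding assms by metis
  obtain \<psi> where "hom_monomial G' w' \<psi> = hom_monomial G w \<phi>"
    using X_series_eq_hom_monomial[OF eq \<phi>(1) fin(1) pos(1)] by blast
  then have "\<psi> ` uverts G' = \<phi> ` uverts G"
    using keys_hom_monomial[of G w \<phi>] keys_hom_monomial[of G' w' \<psi>] fin pos by simp
  then show ?thesis
    using card_image[OF \<phi>(2)] card_image_le[OF fin(2), of \<psi>] by simp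
qed

text \<open>The map runs from \<open>G'\<close> to \<open>G\<close>: a homomorphism from
  \<open>G'\<close> is pulled back through the induced copy of \<open>G\<close>. Edges are
  controlled in this direction only, since \<open>\<psi>\<close> is not known to reflect
  them.\<close>

lemma X_series_eq_bijective_hom:
  assumes H: "universal_graph H" and G: "simple_graph G" "simple_graph G'"
    and fin: "finite (uverts G)" "finite (uverts G')"
    and pos: "\<And>v. v \<in> uverts G \<Longrightarrow> w v \<ge> 1" "\<And>v. v \<in> uverts G' \<Longrightarrow> w' v \<ge> 1"
    and eq: "X_series H G w = X_series H G' w'"
  obtains f where "bij_betw f (uverts G') (uverts G)"
    "\<And>v. v \<in> uverts G' \<Longrightarrow> w (f v) = w' v"
    "\<And>u v. {u, v} \<in> uedges G' \<Longrightarrow> {f u, f v} \<in> uedges G"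
proof -
  obtain \<phi> where \<phi>: "\<phi> \<in> Hom G H" "inj_on \<phi> (uverts G)"
    and edge: "\<And>u v. u \<in> uverts G \<Longrightarrow> v \<in> uverts G \<Longrightarrow> {\<phi> u, \<phi> v} \<in> uedges H \<Longrightarrow>
      {u, v} \<in> uedges G"
    using universal_graph_embedding[OF H G(1) fin(1)] by metis
  obtain \<psi> where \<psi>: "\<psi> \<in> Hom G' H" "hom_monomial G' w' \<psi> = hom_monomial G w \<phi>"
    using X_series_eq_hom_monomial[OF eq \<phi>(1) fin(1) pos(1)] by blast
  have img: "\<psi> ` uverts G' = \<phi> ` uverts G"
    using keys_hom_monomial[of G w \<phi>] keys_hom_monomial[of G' w' \<psi>] fin pos \<psi>(2) by simp
  have "card (uverts G') = card (uverts G)"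
    using X_series_eq_card_le[OF H G(1) fin pos eq]
      X_series_eq_card_le[OF H G(2) fin(2,1) pos(2,1) eq[symmetric]] by simp
  \<comment> \<open>A map on a finite set whose image has the same size is injective.\<close>
  then have "card (\<psi> ` uverts G') = card (uverts G')"
    using img card_image[OF \<phi>(2)] by simp
  then have inj: "inj_on \<psi> (uverts G')"
    using fin(2) by (simp add: eq_card_imp_inj_on)
  define f where "f = inv_into (uverts G) \<phi> \<circ> \<psi>"
  have "\<psi> v \<in> \<phi> ` uverts G" if "v \<in> uverts G'" for v
    using img that by blast
  then have f_in: "f v \<in> uverts G" and \<phi>f: "\<phi> (f v) = \<psi> v" if "v \<in> uverts G'" for v
    using that by (simp_all add: f_def inv_into_into f_inv_into_f)
  show ?thesis
  proof (rule that)
    have "bij_betw \<psi> (uverts G') (\<phi> ` uverts G)"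
      using inj img by (simp add: bij_betw_def)
    then show "bij_betw f (uverts G') (uverts G)"
      unfolding f_def using \<phi>(2)
      by (meson bij_betw_inv_into bij_betw_trans inj_on_imp_bij_betw)
    show "w (f v) = w' v" if v: "v \<in> uverts G'" for v
      \<comment> \<open>Both weights are the exponent of the same variable
        \<open>\<phi> (f v) = \<psi> v\<close> in the common monomial.\<close>
      using lookup_hom_monomial_inj[OF fin(1) \<phi>(2) f_in[OF v], of w]
        lookup_hom_monomial_inj[OF fin(2) inj v, of w'] \<psi>(2) \<phi>f[OF v] by simp
    show "{f u, f v} \<in> uedges G" if uv: "{u, v} \<in> uedges G'" for u v
    proof -
      have V: "u \<in> uverts G'" "v \<in> uverts G'"
        using simple_graph_edgeD[OF G(2) uv] by auto
      have "{\<psi> u, \<psi> v} \<in> uedges H"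
        using \<psi>(1) uv by (simp add: Hom_def)
      then show ?thesis
        using edge[OF f_in[OF V(1)] f_in[OF V(2)]] \<phi>f V by simp
    qed
  qed
qed

text \<open>Vertex maps act on edges by direct image, which inherits injectivity; this supplies the
  edge count.\<close>

lemma bijective_hom_uedges:
  assumes f: "bij_betw f (uverts G) (uverts G')" and G: "simple_graph G" "simple_graph G'"
    and fin: "finite (uverts G')"
    and edge: "\<And>u v. {u, v} \<in> uedges G \<Longrightarrow> {f u, f v} \<in> uedges G'"
  shows "(`) f ` uedges G \<subseteq> uedges G'" "inj_on ((`) f) (uedges G)"
    "card (uedges G) \<le> card (uedges G')"
proof -
  show sub: "(`) f ` uedges G \<subseteq> uedges G'"
  proof clarify
    fix e assume e: "e \<in> uedges G"
    then obtain u v where uv: "e = {u, v}"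
      using simple_graph_edgeE[OF G(1)] by metis
    show "f ` e \<in> uedges G'"
      using edge[of u v] e by (simp add: uv)
  qed
  have "inj_on ((`) f) (Pow (uverts G))"
    using f by (intro inj_on_image_Pow) (simp add: bij_betw_def)
  then show inj: "inj_on ((`) f) (uedges G)"
    using G(1) by (rule_tac inj_on_subset) (auto simp: simple_graph_def)
  show "card (uedges G) \<le> card (uedges G')"
    using card_inj_on_le[OF inj sub finite_uedges[OF G(2) fin]] .
qed

lemma X_series_eq_imp_weighted_graph_iso:
  assumes H: "universal_graph H" and G: "simple_graph G" "simple_graph G'"
    and fin: "finite (uverts G)" "finite (uverts G')"
    and pos: "\<And>v. v \<in> uverts G \<Longrightarrow> w v \<ge> 1" "\<And>v. v \<in> uverts G' \<Longrightarrow> w' v \<ge> 1"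
    and eq: "X_series H G w = X_series H G' w'"
  obtains f where "weighted_graph_iso f G w G' w'"
proof -
  obtain f where f: "bij_betw f (uverts G) (uverts G')"
    "\<And>v. v \<in> uverts G \<Longrightarrow> w' (f v) = w v"
    "\<And>u v. {u, v} \<in> uedges G \<Longrightarrow> {f u, f v} \<in> uedges G'"
    using X_series_eq_bijective_hom[OF H G(2,1) fin(2,1) pos(2,1) eq[symmetric]] by metis
  \<comment> \<open>\<open>g\<close> need not be the inverse of \<open>f\<close>; it serves only to
    bound the number of edges of \<open>G'\<close> by that of \<open>G\<close>.\<close>
  obtain g where g: "bij_betw g (uverts G') (uverts G)"
    "\<And>u v. {u, v} \<in> uedges G' \<Longrightarrow> {g u, g v} \<in> uedges G"
    using X_series_eq_bijective_hom[OF H G fin pos eq] by metis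
  note f_edges = bijective_hom_uedges[OF f(1) G fin(2) f(3)]
  have "card (uedges G) = card (uedges G')"
    using f_edges(3) bijective_hom_uedges(3)[OF g(1) G(2,1) fin(1) g(2)] by simp
  \<comment> \<open>An injection between finite sets of equal size is onto.\<close>
  then have surj: "(`) f ` uedges G = uedges G'"
    using f_edges card_image[OF f_edges(2)] finite_uedges[OF G(2) fin(2)]
    by (intro card_subset_eq) auto
  \<comment> \<open>By surjectivity the edge \<open>{f u, f v}\<close> is the image of some edge
    \<open>e\<close>, and injectivity of \<open>f\<close> forces \<open>e = {u, v}\<close>.\<close>
  have "{u, v} \<in> uedges G"
    if V: "u \<in> uverts G" "v \<in> uverts G" and e': "{f u, f v} \<in> uedges G'" for u v
  proof -
    obtain e where e: "e \<in> uedges G" "f ` e = f ` {u, v}"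
      using e' surj by (metis image_empty image_iff image_insert)
    then have "e = {u, v}"
      using inj_on_image_eq_iff[of f "uverts G" e "{u, v}"] f(1) G(1) V
      by (auto simp: simple_graph_def bij_betw_def)
    then show ?thesis using e by simp
  qed
  then show ?thesis
    using that[of f] f unfolding weighted_graph_iso_def by blast
qed

section \<open>Invariance of the series under weighted isomorphism\<close>

lemma Hom_restrict_comp:
  assumes \<phi>: "\<phi> \<in> Hom G' H" and G: "simple_graph G"
    and f: "\<And>v. v \<in> uverts G \<Longrightarrow> f v \<in> uverts G'"
    and edge: "\<And>u v. {u, v} \<in> uedges G \<Longrightarrow> {f u, f v} \<in> uedges G'"
  shows "restrict (\<phi> \<circ> f) (uverts G) \<in> Hom G H"
  unfolding Hom_def
proof (intro CollectI conjI allI impI)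
  show "restrict (\<phi> \<circ> f) (uverts G) \<in> uverts G \<rightarrow>\<^sub>E uverts H"
    using \<phi> f by (auto simp: Hom_def)
  fix u v assume uv: "{u, v} \<in> uedges G"
  have "{\<phi> (f u), \<phi> (f v)} \<in> uedges H"
    using \<phi> edge[OF uv] by (simp add: Hom_def)
  then show "{restrict (\<phi> \<circ> f) (uverts G) u, restrict (\<phi> \<circ> f) (uverts G) v} \<in> uedges H"
    using simple_graph_edgeD[OF G uv] by simp
qed

text \<open>Precomposition with \<open>f\<close> is a bijection from \<open>Hom G' H\<close> to
  \<open>Hom G H\<close> that keeps the monomial, so every coefficient counts equally many
  maps.\<close>

lemma weighted_graph_iso_imp_X_series_eq:
  assumes iso: "weighted_graph_iso f G w G' w'" and G: "simple_graph G" "simple_graph G'"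
  shows "X_series H G w = X_series H G' w'"
proof
  fix m
  have f: "bij_betw f (uverts G) (uverts G')"
    and edge: "\<And>u v. u \<in> uverts G \<Longrightarrow> v \<in> uverts G \<Longrightarrow>
      {u, v} \<in> uedges G \<longleftrightarrow> {f u, f v} \<in> uedges G'"
    and wt: "\<And>v. v \<in> uverts G \<Longrightarrow> w' (f v) = w v"
    using iso by (auto simp: weighted_graph_iso_def)
  define g where "g = inv_into (uverts G) f"
  have g_in: "g v \<in> uverts G" and fg: "f (g v) = v" if "v \<in> uverts G'" for v
    using f that by (auto simp: g_def bij_betw_inv_into_right bij_betwE[OF bij_betw_inv_into])
  have f_in: "f v \<in> uverts G'" and gf: "g (f v) = v" if "v \<in> uverts G" for v
    using f that by (auto simp: g_def bij_betw_inv_into_left bij_betwE)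
  define F where "F = (\<lambda>\<phi> :: 'b \<Rightarrow> 'c. restrict (\<phi> \<circ> f) (uverts G))"
  define F' where "F' = (\<lambda>\<phi> :: 'a \<Rightarrow> 'c. restrict (\<phi> \<circ> g) (uverts G'))"
  have mon: "hom_monomial G w (F \<phi>) = hom_monomial G' w' \<phi>" for \<phi>
    unfolding hom_monomial_def F_def
    by (subst sum.reindex_bij_betw[OF f, symmetric]) (auto intro!: sum.cong simp: wt)
  have F: "F \<phi> \<in> Hom G H" if "\<phi> \<in> Hom G' H" for \<phi>
    unfolding F_def using that G(1) f_in
  proof (rule Hom_restrict_comp)
    show "{f u, f v} \<in> uedges G'" if "{u, v} \<in> uedges G" for u v
      using edge simple_graph_edgeD[OF G(1) that] that by blast
  qed
  have F': "F' \<phi> \<in> Hom G' H" if "\<phi> \<in> Hom G H" for \<phi>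
    unfolding F'_def using that G(2) g_in
  proof (rule Hom_restrict_comp)
    show "{g u, g v} \<in> uedges G" if "{u, v} \<in> uedges G'" for u v
      using edge[of "g u" "g v"] g_in fg simple_graph_edgeD[OF G(2) that] that by simp
  qed
  \<comment> \<open>Members of \<open>Hom\<close> are extensional, so agreement on the vertices is
    equality.\<close>
  have FF': "F (F' \<phi>) = \<phi>" if "\<phi> \<in> Hom G H" for \<phi>
    using that f_in gf by (auto simp: Hom_def F_def F'_def fun_eq_iff PiE_def extensional_def)
  have F'F: "F' (F \<phi>) = \<phi>" if "\<phi> \<in> Hom G' H" for \<phi>
    using that g_in fg by (auto simp: Hom_def F_def F'_def fun_eq_iff PiE_def extensional_def)
  have "bij_betw F {\<phi> \<in> Hom G' H. hom_monomial G' w' \<phi> = m} {\<phi> \<in> Hom G H. hom_monomial G w \<phi> = m}"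
    using F F' FF' F'F mon by (intro bij_betw_byWitness[where f' = F']) (auto, metis)
  then show "X_series H G w m = X_series H G' w' m"
    by (simp add: X_series_coeff bij_betw_same_card)
qed

section \<open>Weights and covers in the Hasse diagram\<close>

lemma uverts_poset_graph [simp]: "uverts (poset_graph P r) = P"
  by (simp add: poset_graph_def underlying_ugraph_def hasse_digraph_def)

lemma uedges_poset_graph:
  "{u, v} \<in> uedges (poset_graph P r) \<longleftrightarrow> covers P r u v \<or> covers P r v u"
  by (auto simp: poset_graph_def underlying_ugraph_def hasse_digraph_def doubleton_eq_iff)

lemma poset_weight_covers:
  assumes "finite_poset P r"
  shows "poset_weight P r v = (if {u. covers P r v u} = {} then 1
    else 1 + Max (poset_weight P r ` {u. covers P r v u}))"
proof -
  let ?D = "hasse_digraph P r"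
  have "in_arcs (with_proj ?D) v = (\<lambda>u. (u, v)) ` {u. covers P r v u}"
    by (auto simp: in_arcs_def hasse_digraph_def)
  then have "in_degree (with_proj ?D) v = card {u. covers P r v u}"
    by (simp add: in_degree_def card_image inj_on_def)
  \<comment> \<open>Finiteness turns in-degree 0, which is a vanishing cardinality, into emptiness
    of the set.\<close>
  moreover have "finite {u. covers P r v u}"
    using assms by (auto simp: finite_poset_def covers_def intro: finite_subset)
  moreover have "{poset_weight P r u | u. (u, v) \<in> parcs ?D} = poset_weight P r ` {u. covers P r v u}"
    by (auto simp: hasse_digraph_def)
  ultimately show ?thesis
    by (subst poset_weight_rec[OF assms]) auto
qed

lemma poset_weight_less:
  assumes "finite_poset P r" "covers P r v u"
  shows "poset_weight P r u < poset_weight P r v"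
proof -
  have "finite {u. covers P r v u}"
    using assms(1) by (auto simp: finite_poset_def covers_def intro: finite_subset)
  then have "poset_weight P r u \<le> Max (poset_weight P r ` {u. covers P r v u})"
    using assms(2) by (intro Max_ge) auto
  then show ?thesis
    using assms(2) by (subst poset_weight_covers[OF assms(1), of v]) auto
qed

text \<open>Weights strictly increase along covers, so comparing them at the two ends of an
  undirected edge recovers its direction.\<close>

lemma covers_iff_edge_weight:
  assumes "finite_poset P r"
  shows "covers P r v u \<longleftrightarrow>
    {u, v} \<in> uedges (poset_graph P r) \<and> poset_weight P r u < poset_weight P r v"
  using poset_weight_less[OF assms] by (auto simp: uedges_poset_graph dest: less_asym)

text \<open>A comparable pair that is neither equal nor a cover has an element strictly between;
  splitting there leaves two smaller intervals, so induction on interval size applies.\<close>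

lemma finite_poset_rtrancl_covers:
  assumes P: "finite_poset P r" and "(x, y) \<in> r"
  shows "(x, y) \<in> {(u, v). covers P r v u}\<^sup>*"
proof -
  have tr: "trans r" and an: "antisym r" and sub: "r \<subseteq> P \<times> P" and fin: "finite P"
    using P by (auto simp: finite_poset_def partial_order_on_def preorder_on_def)
  have refl: "(z, z) \<in> r" if "z \<in> P" for z
    using P that by (auto simp: finite_poset_def partial_order_on_def preorder_on_def refl_on_def)
  define I where "I = (\<lambda>a b. {z. (a, z) \<in> r \<and> (z, b) \<in> r})"
  have finI: "finite (I a b)" for a b
    using fin sub by (auto simp: I_def intro: finite_subset)
  show ?thesis
    using assms(2)
  proof (induction "card (I x y)" arbitrary: x y rule: less_induct)
    case less
    have xy: "x \<in> P" "y \<in> P"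
      using less.prems sub by auto
    consider "x = y" | "covers P r y x"
      | z where "z \<in> P" "z \<noteq> x" "z \<noteq> y" "(x, z) \<in> r" "(z, y) \<in> r"
      using less.prems xy by (auto simp: covers_def)
    then show ?case
    proof cases
      case 3
      \<comment> \<open>Transitivity gives the inclusion. If \<open>y\<close> lay in
        \<open>I x z\<close>, antisymmetry would give \<open>y = z\<close>; so the endpoint
        \<open>y\<close> is lost, and symmetrically \<open>x\<close> is lost from
        \<open>I z y\<close>.\<close>
      have "I x z \<subseteq> I x y" "y \<in> I x y" "y \<notin> I x z"
        using 3 refl[OF xy(2)] less.prems transD[OF tr _ 3(5)] antisymD[OF an 3(5)]
        by (auto simp: I_def)
      then have "I x z \<subset> I x y"
        by blast
      moreover have "I z y \<subseteq> I x y" "x \<in> I x y" "x \<notin> I z y"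
        using 3 refl[OF xy(1)] less.prems transD[OF tr 3(4)] antisymD[OF an 3(4)]
        by (auto simp: I_def)
      then have "I z y \<subset> I x y"
        by blast
      ultimately show ?thesis
        using less.hyps[of x z] less.hyps[of z y] 3 finI
        by (meson psubset_card_mono rtrancl_trans)
    qed auto
  qed
qed

section \<open>From weighted isomorphism to poset isomorphism and back\<close>

text \<open>Covers are expressible by edges and weights, hence preserved by \<open>f\<close>; a
  chain of covers from \<open>x\<close> to \<open>y\<close> then maps to a chain in
  \<open>s\<close>.\<close>

lemma weighted_graph_iso_imp_order:
  assumes P: "finite_poset P r" and Q: "finite_poset Q s"
    and iso: "weighted_graph_iso f (poset_graph P r) (poset_weight P r)
      (poset_graph Q s) (poset_weight Q s)"
    and xy: "(x, y) \<in> r"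
  shows "(f x, f y) \<in> s"
proof -
  have tr: "trans s" and refl: "\<And>z. z \<in> Q \<Longrightarrow> (z, z) \<in> s"
    using Q by (auto simp: finite_poset_def partial_order_on_def preorder_on_def refl_on_def)
  have f: "f z \<in> Q" if "z \<in> P" for z
    using iso that by (auto simp: weighted_graph_iso_def bij_betwE)
  have x: "x \<in> P"
    using P xy by (auto simp: finite_poset_def partial_order_on_def preorder_on_def)
  have cover_step: "(f u, f v) \<in> s" if "covers P r v u" for u v
  proof -
    have "u \<in> P" "v \<in> P"
      using that by (auto simp: covers_def)
    then have "covers Q s (f v) (f u)"
      using iso that by (simp add: weighted_graph_iso_def covers_iff_edge_weight[OF P]
          covers_iff_edge_weight[OF Q])
    then show ?thesis by (simp add: covers_def)
  qed
  from finite_poset_rtrancl_covers[OF P xy] show ?thesis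
  proof induction
    case base
    then show ?case using refl f x by blast
  next
    case (step y z)
    then show ?case using tr cover_step by (auto dest: transD)
  qed
qed

lemma weighted_graph_iso_imp_poset_isomorphic:
  assumes P: "finite_poset P r" and Q: "finite_poset Q s"
    and iso: "weighted_graph_iso f (poset_graph P r) (poset_weight P r)
      (poset_graph Q s) (poset_weight Q s)"
  shows "poset_isomorphic P r Q s"
proof -
  have f: "bij_betw f P Q"
    using iso by (simp add: weighted_graph_iso_def)
  have "(x, y) \<in> r" if "x \<in> P" "y \<in> P" "(f x, f y) \<in> s" for x y
    \<comment> \<open>Order reflection is order preservation for the inverse map.\<close>
    using weighted_graph_iso_imp_order[OF Q P weighted_graph_iso_inv[OF iso] that(3)] that f
    by (simp add: bij_betw_inv_into_left)
  then show ?thesis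
    using f weighted_graph_iso_imp_order[OF P Q iso] unfolding poset_isomorphic_def by blast
qed

text \<open>Covers are defined from the order alone and weights recursively from covers, so an order
  isomorphism preserves both.\<close>

lemma poset_isomorphic_imp_weighted_graph_iso:
  assumes P: "finite_poset P r" and Q: "finite_poset Q s"
    and iso: "poset_isomorphic P r Q s"
  obtains f where "weighted_graph_iso f (poset_graph P r) (poset_weight P r)
      (poset_graph Q s) (poset_weight Q s)"
proof -
  obtain f where f: "bij_betw f P Q"
    and ord: "\<And>x y. x \<in> P \<Longrightarrow> y \<in> P \<Longrightarrow> (x, y) \<in> r \<longleftrightarrow> (f x, f y) \<in> s"
    using iso by (auto simp: poset_isomorphic_def)
  have Q_eq: "Q = f ` P" and inj: "inj_on f P"
    using f by (auto simp: bij_betw_def)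
  have cov: "covers Q s (f v) (f u) \<longleftrightarrow> covers P r v u" if "u \<in> P" "v \<in> P" for u v
    using that ord inj unfolding covers_def Q_eq by (auto simp: inj_on_eq_iff)
  have wt: "poset_weight Q s (f v) = poset_weight P r v" if "v \<in> P" for v
    \<comment> \<open>Induction along covers: the weights of the elements below \<open>v\<close> are
      already known to agree.\<close>
    using wf_hasse_digraph[OF P] that
  proof (induction v rule: wf_induct_rule)
    case (less v)
    have IH: "poset_weight Q s (f u) = poset_weight P r u" if "covers P r v u" for u
      using less.IH[of u] that by (auto simp: hasse_digraph_def covers_def)
    \<comment> \<open>The elements covered by \<open>f v\<close> are the images of those covered by
      \<open>v\<close>, so both recursions take the same branch and the same maximum.\<close>
    have "{u. covers Q s (f v) u} = f ` {u. covers P r v u}"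
    proof
      show "{u. covers Q s (f v) u} \<subseteq> f ` {u. covers P r v u}"
      proof clarify
        fix u' assume u': "covers Q s (f v) u'"
        then obtain u where "u \<in> P" "u' = f u"
          unfolding covers_def Q_eq by blast
        then show "u' \<in> f ` {u. covers P r v u}"
          using u' cov less.prems by blast
      qed
      show "f ` {u. covers P r v u} \<subseteq> {u. covers Q s (f v) u}"
      proof clarify
        fix u assume u: "covers P r v u"
        then have "u \<in> P"
          by (simp add: covers_def)
        then show "covers Q s (f v) (f u)"
          using u cov less.prems by blast
      qed
    qed
    moreover have "poset_weight Q s ` f ` {u. covers P r v u} = poset_weight P r ` {u. covers P r v u}"
      using IH by (force simp: image_image)
    ultimately show ?case
      by (auto simp: poset_weight_covers[OF P, of v] poset_weight_covers[OF Q, of "f v"])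
  qed
  show ?thesis
    by (rule that[of f]) (auto simp: weighted_graph_iso_def f wt uedges_poset_graph cov)
qed

section \<open>Completeness of the invariant\<close>

lemma Z_series_eq_iff_poset_isomorphic:
  assumes H: "universal_graph H" and P: "finite_poset P r" and Q: "finite_poset Q s"
  shows "Z_series H P r = Z_series H Q s \<longleftrightarrow> poset_isomorphic P r Q s"
proof
  assume "Z_series H P r = Z_series H Q s"
  then obtain f where "weighted_graph_iso f (poset_graph P r) (poset_weight P r)
      (poset_graph Q s) (poset_weight Q s)"
    using X_series_eq_imp_weighted_graph_iso[OF H simple_graph_poset_graph
        simple_graph_poset_graph, of P r Q s "poset_weight P r" "poset_weight Q s"] P Q
      poset_weight_pos[OF P] poset_weight_pos[OF Q]
    by (auto simp: Z_series_def finite_poset_def)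
  then show "poset_isomorphic P r Q s"
    by (rule weighted_graph_iso_imp_poset_isomorphic[OF P Q])
next
  assume "poset_isomorphic P r Q s"
  then show "Z_series H P r = Z_series H Q s"
    using poset_isomorphic_imp_weighted_graph_iso[OF P Q] weighted_graph_iso_imp_X_series_eq
      simple_graph_poset_graph unfolding Z_series_def by metis
qed

theorem corollary5p2:
  shows "(\<forall>H :: 'h ugraph. universal_graph H \<longrightarrow>
            (\<forall>(P1 :: 'a set) r1 (P2 :: 'b set) r2.
               finite_poset P1 r1 \<and> finite_poset P2 r2 \<longrightarrow>
               (Z_series H P1 r1 = Z_series H P2 r2 \<longleftrightarrow> poset_isomorphic P1 r1 P2 r2)))
       \<and> (\<forall>H :: nat \<Rightarrow> 'h ugraph. (\<forall>n. universal_graph (H n)) \<longrightarrow>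
            (\<forall>(P1 :: 'a set) r1 (P2 :: 'b set) r2.
               finite_poset P1 r1 \<and> finite_poset P2 r2 \<longrightarrow>
               ((\<forall>n. Z_series (H n) P1 r1 = Z_series (H n) P2 r2) \<longleftrightarrow>
                poset_isomorphic P1 r1 P2 r2)))"
  \<comment> \<open>For a sequence, equality at any one index already yields the isomorphism, and an
    isomorphism yields equality at every index.\<close>
  using Z_series_eq_iff_poset_isomorphic by blast

end
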